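(* Let $n \geq 1$ and $k \geq 3$ be integers. If the hypercube $Q_n$ has a $C_k$-decomposition, then $Q_{mn}$ has an $L_{2k}$-decomposition for every integer $m \geq 2$.
   Context: For a positive integer $n$, the hypercube $Q_n$ is the graph whose vertices are the binary strings $x_1x_2\cdots x_n$ ($x_i\in\{0,1\}$), two vertices being adjacent if and only if they differ in exactly one position. $C_k$ denotes the cycle of length $k$. For $k \geq 3$, the sunlet graph $L_{2k}$ is the graph obtained from $C_k$ by attaching one pendant edge (to a new vertex) at each vertex of the cycle. For a graph $H$, an $H$-decomposition of a graph $G$ is a collection of edge-disjoint subgraphs of $G$, each isomorphic to $H$, whose edge sets partition $E(G)$. *)

theory Defs
  imports Main "HOL-Library.Disjoint_Sets"
begin

record 'a graph =
  verts :: "'a set"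
  edges :: "'a set set"

definition simple_graph :: "'a graph \<Rightarrow> bool" where
  "simple_graph G \<longleftrightarrow> (\<forall>e \<in> edges G. e \<subseteq> verts G \<and> card e = 2)"

definition subgraph :: "'a graph \<Rightarrow> 'a graph \<Rightarrow> bool" where
  "subgraph S G \<longleftrightarrow> simple_graph S \<and> verts S \<subseteq> verts G \<and> edges S \<subseteq> edges G"

definition isomorphic :: "'a graph \<Rightarrow> 'b graph \<Rightarrow> bool" where
  "isomorphic G H \<longleftrightarrow>
     (\<exists>f. bij_betw f (verts G) (verts H) \<and>
          (\<forall>u \<in> verts G. \<forall>v \<in> verts G. {u, v} \<in> edges G \<longleftrightarrow> {f u, f v} \<in> edges H))"

definition is_decomposition :: "'b graph \<Rightarrow> 'a graph \<Rightarrow> 'a graph set \<Rightarrow> bool" where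
  "is_decomposition H G \<D> \<longleftrightarrow>
     (\<forall>S \<in> \<D>. subgraph S G \<and> isomorphic S H) \<and>
     disjoint_family_on edges \<D> \<and>
     (\<Union>S \<in> \<D>. edges S) = edges G"

definition has_decomposition :: "'b graph \<Rightarrow> 'a graph \<Rightarrow> bool" where
  "has_decomposition H G \<longleftrightarrow> (\<exists>\<D>. is_decomposition H G \<D>)"

definition hypercube :: "nat \<Rightarrow> bool list graph" where
  "hypercube n = \<lparr>
     verts = {x. length x = n},
     edges = {{x, y} | x y. length x = n \<and> length y = n \<and> card {i. i < n \<and> x ! i \<noteq> y ! i} = 1}\<rparr>"

text \<open>A cycle only for \<open>k \<ge> 3\<close>; the smaller values of \<open>k\<close> are degenerate.\<close>

definition cycle_graph :: "nat \<Rightarrow> nat graph" where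
  "cycle_graph k = \<lparr>
     verts = {0..<k},
     edges = {{i, Suc i mod k} | i. i < k}\<rparr>"

text \<open>\<open>Inl v\<close> is the original vertex \<open>v\<close>, and \<open>Inr v\<close> is the new leaf attached to it.\<close>

definition attach_pendants :: "'a graph \<Rightarrow> ('a + 'a) graph" where
  "attach_pendants G = \<lparr>
     verts = Inl ` verts G \<union> Inr ` verts G,
     edges = (\<lambda>e. Inl ` e) ` edges G \<union> {{Inl v, Inr v} | v. v \<in> verts G}\<rparr>"

text \<open>The argument is the length of the cycle: \<open>sunlet_graph k\<close> is \<open>L\<^bsub>2k\<^esub>\<close>,
  the sunlet graph on \<open>2k\<close> vertices.\<close>

definition sunlet_graph :: "nat \<Rightarrow> (nat + nat) graph" where
  "sunlet_graph k = attach_pendants (cycle_graph k)"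

lemma simple_graph_hypercube: "simple_graph (hypercube n)"
proof -
  have "x \<noteq> y" if "card {i. i < n \<and> x ! i \<noteq> y ! i} = 1" for x y :: "bool list"
    using that by auto
  then show ?thesis
    by (auto simp: simple_graph_def hypercube_def card_2_iff)
qed

lemma simple_graph_cycle_graph:
  assumes "k \<ge> 3"
  shows "simple_graph (cycle_graph k)"
proof -
  have "i \<noteq> Suc i mod k" if "i < k" for i
    using that assms by (cases "Suc i = k") auto
  then show ?thesis
    using assms by (auto simp: simple_graph_def cycle_graph_def)
qed

lemma simple_graph_attach_pendants:
  assumes "simple_graph G"
  shows "simple_graph (attach_pendants G)"
  using assms by (fastforce simp: simple_graph_def attach_pendants_def card_image)

lemma simple_graph_sunlet_graph: "k \<ge> 3 \<Longrightarrow> simple_graph (sunlet_graph k)"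
  by (simp add: sunlet_graph_def simple_graph_attach_pendants simple_graph_cycle_graph)

end

theory Submission
  imports Defs
begin

text \<open>
  View \<open>Q\<^bsub>mn\<^esub>\<close> as the \<open>m\<close>-fold Cartesian power of \<open>Q\<^sub>n\<close>. Each copy of \<open>Q\<^sub>n\<close> inside it, in one of
  the \<open>m\<close> directions, is either cut into cycles or oriented, its arcs then serving as pendant edges.
  If at every vertex the cycles are as many as the outgoing arcs, any matching of the two
  yields sunlets: pendant edges leave a cycle in a direction other than that of the cycle, so their
  ends are distinct and off the cycle.

  Every vertex of \<open>Q\<^sub>n\<close> lies on \<open>r = n/2\<close> cycles. Directions are paired off, one cut into cycles and
  the other oriented along its cycles, with out-degree \<open>r\<close>. For odd \<open>m\<close> three directions are left,
  and there the parities of the three blocks decide: a copy is oriented if the other two blocks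
  have the same parity, namely towards its vertices of that parity, and cut into cycles otherwise.
  A vertex with three equal parities then has no cycles and no outgoing arcs; any other vertex has
  \<open>2r\<close> cycles, from two directions, and all \<open>2r = n\<close> edges of the third direction go out.
\<close>

section \<open>Images of graphs, isomorphisms, and transport of decompositions\<close>

definition map_graph :: "('a \<Rightarrow> 'b) \<Rightarrow> 'a graph \<Rightarrow> 'b graph" where
  "map_graph f G = \<lparr>verts = f ` verts G, edges = (`) f ` edges G\<rparr>"

lemma verts_map_graph [simp]: "verts (map_graph f G) = f ` verts G"
  and edges_map_graph [simp]: "edges (map_graph f G) = (`) f ` edges G"
  by (simp_all add: map_graph_def)

lemma simple_graphD:
  assumes "simple_graph G" "{u, v} \<in> edges G"
  shows "u \<in> verts G" "v \<in> verts G" "u \<noteq> v"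
  using assms by (auto simp: simple_graph_def)

lemma simple_graph_edgeE:
  assumes "simple_graph G" "e \<in> edges G"
  obtains u v where "e = {u, v}" "u \<noteq> v" "u \<in> verts G" "v \<in> verts G"
proof -
  from assms have "e \<subseteq> verts G" "card e = 2" by (auto simp: simple_graph_def)
  then show ?thesis using that by (auto simp: card_2_iff)
qed

lemma simple_graph_map_graph:
  assumes "simple_graph G" "inj_on f (verts G)"
  shows "simple_graph (map_graph f G)"
  unfolding simple_graph_def
proof
  fix e assume "e \<in> edges (map_graph f G)"
  then obtain d where d: "d \<in> edges G" "e = f ` d" by auto
  with assms(1) have "d \<subseteq> verts G" "card d = 2" by (auto simp: simple_graph_def)
  with d assms(2) show "e \<subseteq> verts (map_graph f G) \<and> card e = 2"
    by (auto simp: card_image inj_on_subset)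
qed

lemma isomorphic_sym:
  assumes "isomorphic G H"
  shows "isomorphic H G"
proof -
  from assms obtain f where f: "bij_betw f (verts G) (verts H)"
    "\<forall>u \<in> verts G. \<forall>v \<in> verts G. {u, v} \<in> edges G \<longleftrightarrow> {f u, f v} \<in> edges H"
    by (auto simp: isomorphic_def)
  let ?g = "inv_into (verts G) f"
  have "bij_betw ?g (verts H) (verts G)" using f(1) by (rule bij_betw_inv_into)
  moreover have "f (?g x) = x" "?g x \<in> verts G" if "x \<in> verts H" for x
    using f(1) that by (auto simp: bij_betw_inv_into_right bij_betw_imp_surj_on intro: inv_into_into)
  ultimately show ?thesis unfolding isomorphic_def using f(2) by metis
qed

lemma isomorphic_trans:
  assumes "isomorphic G H" "isomorphic H K"
  shows "isomorphic G K"
proof -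
  from assms obtain f g where f: "bij_betw f (verts G) (verts H)"
    "\<forall>u \<in> verts G. \<forall>v \<in> verts G. {u, v} \<in> edges G \<longleftrightarrow> {f u, f v} \<in> edges H"
    and g: "bij_betw g (verts H) (verts K)"
    "\<forall>u \<in> verts H. \<forall>v \<in> verts H. {u, v} \<in> edges H \<longleftrightarrow> {g u, g v} \<in> edges K"
    by (auto simp: isomorphic_def)
  have "bij_betw (g \<circ> f) (verts G) (verts K)" using f(1) g(1) by (rule bij_betw_trans)
  moreover have "f x \<in> verts H" if "x \<in> verts G" for x
    using f(1) that by (rule bij_betwE[rule_format])
  ultimately show ?thesis unfolding isomorphic_def
    by (intro exI[of _ "g \<circ> f"]) (simp add: f(2) g(2))
qed

lemma isomorphic_map_graph:
  assumes "simple_graph G" "inj_on f (verts G)"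
  shows "isomorphic G (map_graph f G)"
proof -
  have "{u, v} \<in> edges G \<longleftrightarrow> {f u, f v} \<in> (`) f ` edges G"
    if "u \<in> verts G" "v \<in> verts G" for u v
  proof -
    have "{f u, f v} \<in> (`) f ` edges G \<longleftrightarrow> (\<exists>e \<in> edges G. f ` {u, v} = f ` e)"
      by auto
    also have "\<dots> \<longleftrightarrow> (\<exists>e \<in> edges G. {u, v} = e)"
      using assms that by (intro bex_cong refl inj_on_image_eq_iff) (auto simp: simple_graph_def)
    finally show ?thesis by auto
  qed
  then show ?thesis unfolding isomorphic_def
    using assms(2) by (intro exI[of _ f]) (auto simp: bij_betw_def)
qed

text \<open>Edges are sets of vertices of \<open>G\<close>, so a map injective on vertices is
  injective on edges too, and edge-disjointness survives. This later carries sunlet decompositions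
  from the power of \<open>hypercube n\<close> to \<open>hypercube (m * n)\<close>.\<close>

lemma has_decomposition_map_graph:
  assumes G: "simple_graph G" and f: "inj_on f (verts G)" and "has_decomposition H G"
  shows "has_decomposition H (map_graph f G)"
proof -
  from assms obtain D where D: "is_decomposition H G D" by (auto simp: has_decomposition_def)
  have S: "simple_graph S" "verts S \<subseteq> verts G" "edges S \<subseteq> edges G" "isomorphic S H" if "S \<in> D" for S
    using D that by (auto simp: is_decomposition_def subgraph_def)
  have inj: "inj_on ((`) f) (edges G)"
    using f G by (intro inj_onI) (auto simp: simple_graph_def inj_on_image_eq_iff)
  have "is_decomposition H (map_graph f G) (map_graph f ` D)"
    unfolding is_decomposition_def
  proof (intro conjI ballI)
    fix S' assume "S' \<in> map_graph f ` D"
    then obtain S where S': "S \<in> D" "S' = map_graph f S" by auto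
    have "inj_on f (verts S)" using f S(2)[OF S'(1)] by (rule inj_on_subset)
    note inj = this
    show "subgraph S' (map_graph f G)"
      unfolding S' subgraph_def using S[OF S'(1)] inj by (auto simp: simple_graph_map_graph)
    show "isomorphic S' H"
      unfolding S' using isomorphic_map_graph[OF S(1)[OF S'(1)] inj] S(4)[OF S'(1)]
      by (metis isomorphic_sym isomorphic_trans)
  next
    have "disjoint_family_on edges D" using D by (simp add: is_decomposition_def)
    then have "edges (map_graph f S) \<inter> edges (map_graph f S') = {}"
      if "S \<in> D" "S' \<in> D" "S \<noteq> S'" for S S'
      using that inj_on_image_Int[OF inj S(3)[OF that(1)] S(3)[OF that(2)]]
      by (simp add: disjoint_family_on_def)
    then show "disjoint_family_on edges (map_graph f ` D)"
      unfolding disjoint_family_on_def by blast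
  next
    show "(\<Union>S\<in>map_graph f ` D. edges S) = edges (map_graph f G)"
    proof -
      have "edges G = (\<Union>S\<in>D. edges S)" using D by (simp add: is_decomposition_def)
      then show ?thesis by (simp add: image_UN)
    qed
  qed
  then show ?thesis by (auto simp: has_decomposition_def)
qed

section \<open>Orientations, and pendant edges obtained from outgoing arcs\<close>

text \<open>Asymmetry rules out loops and opposite arcs, so each edge carries exactly one arc. An
  arc \<open>(v, w)\<close> will become a pendant edge of some cycle through its tail
  \<open>v\<close>.\<close>

definition orientation :: "'a graph \<Rightarrow> 'a rel \<Rightarrow> bool" where
  "orientation G A \<longleftrightarrow> asym A \<and> edges G = {{v, w} | v w. (v, w) \<in> A}"

lemma orientationD:
  assumes "orientation G A" "(v, w) \<in> A"
  shows "{v, w} \<in> edges G" "(w, v) \<notin> A" "v \<noteq> w"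
  using assms by (auto simp: orientation_def asym_iff)

lemma orientation_edge:
  assumes "orientation G A" "{v, w} \<in> edges G"
  shows "(v, w) \<in> A \<or> (w, v) \<in> A"
  using assms by (auto simp: orientation_def doubleton_eq_iff)

text \<open>Unlike in \<open>attach_pendants\<close>, the leaves come from the vertex type of
  \<open>S\<close> itself, so \<open>p\<close> will be required to be injective on
  \<open>verts S\<close> and to lead out of it.\<close>

definition add_pendants :: "('a \<Rightarrow> 'a) \<Rightarrow> 'a graph \<Rightarrow> 'a graph" where
  "add_pendants p S = \<lparr>verts = verts S \<union> p ` verts S,
     edges = edges S \<union> (\<lambda>v. {v, p v}) ` verts S\<rparr>"

text \<open>The two conditions on \<open>p\<close> are what makes the natural map from
  \<open>attach_pendants H\<close> injective; its image is \<open>add_pendants p S\<close>, and an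
  injective image is isomorphic to the original.\<close>

lemma isomorphic_add_pendants:
  assumes S: "simple_graph S" and iso: "isomorphic S H" and H: "simple_graph H"
    and p: "inj_on p (verts S)" "p ` verts S \<inter> verts S = {}"
  shows "isomorphic (add_pendants p S) (attach_pendants H)"
proof -
  from iso obtain f where f: "bij_betw f (verts S) (verts H)"
    "\<forall>u \<in> verts S. \<forall>v \<in> verts S. {u, v} \<in> edges S \<longleftrightarrow> {f u, f v} \<in> edges H"
    by (auto simp: isomorphic_def)
  define g where "g = case_sum (inv_into (verts S) f) (p \<circ> inv_into (verts S) f)"
  let ?h = "inv_into (verts S) f"
  have h: "bij_betw ?h (verts H) (verts S)" using f(1) by (rule bij_betw_inv_into)
  have hS: "?h x \<in> verts S" if "x \<in> verts H" for x using h that by (rule bij_betwE[rule_format])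
  have fh: "f (?h x) = x" if "x \<in> verts H" for x
    using f(1) that by (simp add: bij_betw_inv_into_right)
  have hE: "{?h x, ?h y} \<in> edges S \<longleftrightarrow> {x, y} \<in> edges H" if "x \<in> verts H" "y \<in> verts H" for x y
    using f(2) hS fh that by metis
  have him: "?h ` verts H = verts S" using h by (rule bij_betw_imp_surj_on)
  have hinj: "?h x = ?h y \<longleftrightarrow> x = y" if "x \<in> verts H" "y \<in> verts H" for x y
    using h that by (auto simp: bij_betw_def inj_on_def)
  have pinj: "p x = p y \<longleftrightarrow> x = y" if "x \<in> verts S" "y \<in> verts S" for x y
    using p(1) that by (auto simp: inj_on_def)
  have pS: "p x \<noteq> y" "y \<noteq> p x" if "x \<in> verts S" "y \<in> verts S" for x y
    using p(2) that by auto
  have img: "g ` verts (attach_pendants H) = verts (add_pendants p S)"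
  proof -
    have "p ` verts S = (\<lambda>x. p (?h x)) ` verts H"
      unfolding image_image[symmetric] him ..
    then show ?thesis
      by (simp add: g_def attach_pendants_def add_pendants_def image_Un image_image him)
  qed
  have inj: "inj_on g (verts (attach_pendants H))"
    by (rule inj_onI) (auto simp: g_def attach_pendants_def hinj pinj pS hS)
  have edges: "edges (add_pendants p S) = (`) g ` edges (attach_pendants H)"
  proof -
    have 1: "edges S = (\<lambda>e. ?h ` e) ` edges H"
    proof (intro equalityI subsetI)
      fix e assume e: "e \<in> edges S"
      then obtain u v where uv: "e = {u, v}" "u \<in> verts S" "v \<in> verts S"
        using S by (metis simple_graph_edgeE)
      then have "{f u, f v} \<in> edges H" using e f(2) by auto
      moreover have "?h ` {f u, f v} = e" using uv f(1) by (auto simp: bij_betw_inv_into_left)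
      ultimately show "e \<in> (\<lambda>e. ?h ` e) ` edges H" by blast
    next
      fix e assume "e \<in> (\<lambda>e. ?h ` e) ` edges H"
      then obtain d where d: "d \<in> edges H" "e = ?h ` d" by auto
      then obtain u v where uv: "d = {u, v}" "u \<in> verts H" "v \<in> verts H"
        using H by (metis simple_graph_edgeE)
      then show "e \<in> edges S" using hE d by auto
    qed
    have 2: "(\<lambda>v. {v, p v}) ` verts S = (\<lambda>v. {?h v, p (?h v)}) ` verts H"
      using image_image[of "\<lambda>v. {v, p v}" ?h "verts H"] by (simp add: him)
    have 3: "{{Inl v, Inr v} |v. v \<in> verts H} = (\<lambda>v. {Inl v, Inr v}) ` verts H" by auto
    show ?thesis
      unfolding add_pendants_def attach_pendants_def by (simp add: 1 2 3 image_Un image_image g_def)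
  qed
  have "add_pendants p S = map_graph g (attach_pendants H)"
    using img edges by simp
  then show ?thesis
    using isomorphic_map_graph[OF simple_graph_attach_pendants[OF H] inj] isomorphic_sym by metis
qed

text \<open>At each vertex the copies of \<open>H\<close> through it are matched with the arcs
  leaving it, and each copy takes its matched arc as pendant edge there. \<open>out\<close> keeps
  the leaves off the copy, \<open>sep\<close> keeps them distinct. No edge is missed or repeated,
  since an arc has one tail and is matched with one copy.\<close>

lemma attach_pendants_decomposition:
  fixes G :: "'a graph" and H :: "'b graph"
  assumes G: "simple_graph G" and H: "simple_graph H"
    and C: "\<And>S. S \<in> C \<Longrightarrow> subgraph S G" "\<And>S. S \<in> C \<Longrightarrow> isomorphic S H"
    and disj: "disjoint_family_on edges C"
    and A: "orientation \<lparr>verts = verts G, edges = edges G - (\<Union>S\<in>C. edges S)\<rparr> A"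
    and fin: "\<And>v. v \<in> verts G \<Longrightarrow> finite {S \<in> C. v \<in> verts S}" "\<And>v. v \<in> verts G \<Longrightarrow> finite (A `` {v})"
    and card: "\<And>v. v \<in> verts G \<Longrightarrow> card {S \<in> C. v \<in> verts S} = card (A `` {v})"
    and out: "\<And>S v w. S \<in> C \<Longrightarrow> v \<in> verts S \<Longrightarrow> (v, w) \<in> A \<Longrightarrow> w \<notin> verts S"
    and sep: "\<And>S v v' w. S \<in> C \<Longrightarrow> v \<in> verts S \<Longrightarrow> v' \<in> verts S \<Longrightarrow> (v, w) \<in> A \<Longrightarrow> (v', w) \<in> A \<Longrightarrow> v = v'"
  shows "has_decomposition (attach_pendants H) G"
proof -
  have "\<exists>b. bij_betw b {S \<in> C. v \<in> verts S} (A `` {v})" if "v \<in> verts G" for v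
    using that fin card by (intro finite_same_card_bij) auto
  \<comment> \<open>\<open>b v\<close> is the matching at \<open>v\<close>, with arcs leaving
    \<open>v\<close> represented by their heads.\<close>
  then obtain b where b: "\<And>v. v \<in> verts G \<Longrightarrow> bij_betw (b v) {S \<in> C. v \<in> verts S} (A `` {v})"
    by metis
  have V: "simple_graph S" "verts S \<subseteq> verts G" "edges S \<subseteq> edges G" if "S \<in> C" for S
    using C(1)[OF that] by (auto simp: subgraph_def)
  have bA: "(v, b v S) \<in> A" if "S \<in> C" "v \<in> verts S" for S v
    using bij_betwE[OF b] that V by blast
  have binj: "S = S'" if "b v S = b v S'" "S \<in> C" "v \<in> verts S" "S' \<in> C" "v \<in> verts S'" for v S S'
    using b[of v] that V(2)[OF that(2)] unfolding bij_betw_def inj_on_def by blast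
  have AE: "{v, w} \<in> edges G" "\<And>S. S \<in> C \<Longrightarrow> {v, w} \<notin> edges S" "(w, v) \<notin> A" if "(v, w) \<in> A" for v w
    using orientationD[OF A that] by auto
  define F where "F S = add_pendants (\<lambda>v. b v S) S" for S
  have eF: "edges (F S) = edges S \<union> (\<lambda>v. {v, b v S}) ` verts S" for S
    by (simp add: F_def add_pendants_def)
  have vF: "verts (F S) = verts S \<union> (\<lambda>v. b v S) ` verts S" for S
    by (simp add: F_def add_pendants_def)
  have "is_decomposition (attach_pendants H) G (F ` C)"
    unfolding is_decomposition_def
  proof (intro conjI ballI)
    fix S' assume "S' \<in> F ` C"
    then obtain S where S: "S \<in> C" "S' = F S" by auto
    show "isomorphic S' (attach_pendants H)"
      unfolding S(2) F_def
    proof (rule isomorphic_add_pendants)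
      show "inj_on (\<lambda>v. b v S) (verts S)"
        using sep[OF S(1)] bA[OF S(1)] by (intro inj_onI) metis
      show "(\<lambda>v. b v S) ` verts S \<inter> verts S = {}"
        using out[OF S(1)] bA[OF S(1)] by blast
    qed (use S V C H in auto)
    have sub: "edges S' \<subseteq> edges G" using S V(3) bA AE(1) by (auto simp: eF)
    moreover have "verts S' \<subseteq> verts G"
      using S V(2) simple_graphD[OF G AE(1)[OF bA]] by (auto simp: vF)
    moreover have "simple_graph S'"
      unfolding simple_graph_def
    proof (intro ballI conjI)
      fix e assume e: "e \<in> edges S'"
      then show "card e = 2" using sub G by (auto simp: simple_graph_def)
      show "e \<subseteq> verts S'" using e V(1)[OF S(1)] unfolding S eF vF simple_graph_def by auto
    qed
    ultimately show "subgraph S' G" by (simp add: subgraph_def)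
  next
    have "edges (F S) \<inter> edges (F S') = {}" if S: "S \<in> C" "S' \<in> C" "S \<noteq> S'" for S S'
    proof -
      have "edges S \<inter> edges S' = {}" using disj S by (auto simp: disjoint_family_on_def)
      moreover have "{v, b v T} \<notin> edges T'" if "T \<in> C" "T' \<in> C" "v \<in> verts T" for T T' v
        using that AE(2) bA by blast
      \<comment> \<open>If the two pendant edges coincide with equal tails, injectivity of the
        matching gives \<open>S = S'\<close>; with tails exchanged, they contradict asymmetry of
        \<open>A\<close>.\<close>
      moreover have "{v, b v S} \<noteq> {w, b w S'}" if "v \<in> verts S" "w \<in> verts S'" for v w
        using binj[of v S S'] bA[OF S(1) that(1)] bA[OF S(2) that(2)] AE(3) S that
        by (auto simp: doubleton_eq_iff)
      ultimately show ?thesis using S unfolding eF by blast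
    qed
    then show "disjoint_family_on edges (F ` C)"
      unfolding disjoint_family_on_def by blast
  next
    show "(\<Union>S\<in>F ` C. edges S) = edges G"
    proof (intro equalityI subsetI)
      fix e assume "e \<in> (\<Union>S\<in>F ` C. edges S)"
      then show "e \<in> edges G" using V(3) AE(1) bA by (auto simp: eF)
    next
      fix e assume e: "e \<in> edges G"
      show "e \<in> (\<Union>S\<in>F ` C. edges S)"
      proof (cases "e \<in> (\<Union>S\<in>C. edges S)")
        case True
        then show ?thesis by (auto simp: eF)
      next
        case False
        \<comment> \<open>An edge outside all copies is an arc, and surjectivity of the matching at
          its tail yields the copy that carries it.\<close>
        have "edges G - (\<Union>S\<in>C. edges S) = {{v, w} | v w. (v, w) \<in> A}"
          using A by (simp add: orientation_def)
        moreover have "e \<in> edges G - (\<Union>S\<in>C. edges S)" using e False by blast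
        ultimately obtain v w where vw: "e = {v, w}" "(v, w) \<in> A" by auto
        have "v \<in> verts G" using simple_graphD[OF G AE(1)[OF vw(2)]] by simp
        from b[OF this] vw(2) obtain S where "S \<in> C" "v \<in> verts S" "w = b v S"
          unfolding bij_betw_def by blast
        with vw show ?thesis by (auto simp: eF)
      qed
    qed
  qed
  then show ?thesis by (auto simp: has_decomposition_def)
qed


section \<open>Cyclic orientations of cycles and of cycle decompositions\<close>

text \<open>For \<open>k = 2\<close> the two arcs of the cycle would be opposite;
  \<open>k \<ge> 3\<close> is what makes the cyclic orientation asymmetric.\<close>

lemma Suc_mod_asym:
  assumes k: "k \<ge> 3" and "a < k" and b: "b = Suc a mod k"
  shows "Suc b mod k \<noteq> a"
proof (cases "Suc a = k")
  case True
  then show ?thesis using k b by simp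
next
  case False
  then have "b = Suc a" using assms by simp
  then show ?thesis using k assms(2) by (simp add: mod_Suc)
qed

lemma Suc_mod_inj:
  assumes "a < k" "b < k" "Suc a mod k = Suc b mod k"
  shows "a = b"
  using assms by (auto simp add: mod_Suc split: if_splits)

text \<open>The arcs from each number to its successor modulo \<open>k\<close> are pulled back along
  the isomorphism; the successor modulo \<open>k\<close> is a bijection, whence one arc out of and
  one arc into every vertex.\<close>

lemma cycle_graph_orientation:
  assumes k: "k \<ge> 3" and S: "simple_graph S" and iso: "isomorphic S (cycle_graph k)"
  shows "\<exists>A. orientation S A \<and> (\<forall>v \<in> verts S. (\<exists>!w. (v, w) \<in> A) \<and> (\<exists>!w. (w, v) \<in> A))"
proof -
  from iso obtain f where f: "bij_betw f (verts S) {0..<k}"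
    and fE: "\<And>u v. u \<in> verts S \<Longrightarrow> v \<in> verts S \<Longrightarrow>
      {u, v} \<in> edges S \<longleftrightarrow> {f u, f v} \<in> edges (cycle_graph k)"
    by (auto simp: isomorphic_def cycle_graph_def)
  have fk: "f v < k" if "v \<in> verts S" for v using bij_betwE[OF f] that by auto
  have finj: "u = v" if "f u = f v" "u \<in> verts S" "v \<in> verts S" for u v
    using f that by (auto simp: bij_betw_def inj_on_def)
  have fsurj: "\<exists>v \<in> verts S. f v = i" if "i < k" for i
  proof -
    have "i \<in> f ` verts S" using f that by (simp add: bij_betw_def)
    then show ?thesis by blast
  qed
  define A where "A = {(v, w). v \<in> verts S \<and> w \<in> verts S \<and> f w = Suc (f v) mod k}"
  have fE': "{u, v} \<in> edges S \<longleftrightarrow> (u, v) \<in> A \<or> (v, u) \<in> A" if "u \<in> verts S" "v \<in> verts S" for u v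
  proof -
    have "{u, v} \<in> edges S \<longleftrightarrow> (\<exists>i<k. {f u, f v} = {i, Suc i mod k})"
      using that by (auto simp: fE cycle_graph_def)
    also have "\<dots> \<longleftrightarrow> f v = Suc (f u) mod k \<or> f u = Suc (f v) mod k"
      unfolding doubleton_eq_iff using fk[OF that(1)] fk[OF that(2)] by blast
    also have "\<dots> \<longleftrightarrow> (u, v) \<in> A \<or> (v, u) \<in> A"
      using that unfolding A_def by blast
    finally show ?thesis .
  qed
  have "edges S = {{v, w} | v w. (v, w) \<in> A}"
  proof (intro equalityI subsetI)
    fix e assume e: "e \<in> edges S"
    then obtain u v where uv: "e = {u, v}" "u \<in> verts S" "v \<in> verts S"
      using S by (metis simple_graph_edgeE)
    then have "(u, v) \<in> A \<or> (v, u) \<in> A" using fE' e by simp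
    then show "e \<in> {{v, w} | v w. (v, w) \<in> A}" using uv(1) by (auto simp: insert_commute)
  next
    fix e assume "e \<in> {{v, w} | v w. (v, w) \<in> A}"
    then show "e \<in> edges S" using fE' by (auto simp: A_def)
  qed
  moreover have "asym A"
    unfolding asym_iff
  proof (intro allI impI notI)
    fix v w assume "(v, w) \<in> A" "(w, v) \<in> A"
    then have "f v < k" "f w = Suc (f v) mod k" "f v = Suc (f w) mod k"
      using fk unfolding A_def by blast+
    then show False using Suc_mod_asym[OF k] by metis
  qed
  moreover have "(\<exists>!w. (v, w) \<in> A) \<and> (\<exists>!w. (w, v) \<in> A)" if v: "v \<in> verts S" for v
  proof
    have "Suc (f v) mod k < k" using k by simp
    then obtain w where "w \<in> verts S" "f w = Suc (f v) mod k" using fsurj by blast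
    then have "(v, w) \<in> A" using v by (simp add: A_def)
    moreover have "u = w" if "(v, u) \<in> A" for u
      using that \<open>(v, w) \<in> A\<close> by (intro finj) (simp_all add: A_def)
    ultimately show "\<exists>!w. (v, w) \<in> A" by (rule ex1I)
    \<comment> \<open>The predecessor of \<open>f v\<close> modulo \<open>k\<close>; the value 0
      wraps around to \<open>k - 1\<close>.\<close>
    define i where "i = (if f v = 0 then k - 1 else f v - 1)"
    have i: "i < k" "Suc i mod k = f v" using fk[OF v] k by (auto simp: i_def)
    then obtain w where "w \<in> verts S" "f w = i" using fsurj by auto
    then have "(w, v) \<in> A" using i v by (simp add: A_def)
    moreover have "u = w" if "(u, v) \<in> A" for u
    proof (rule finj)
      show "f u = f w"
        using that \<open>(w, v) \<in> A\<close> fk[of u] fk[of w] by - (rule Suc_mod_inj[of _ k]; auto simp: A_def)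
    qed (use that \<open>w \<in> verts S\<close> in \<open>auto simp: A_def\<close>)
    ultimately show "\<exists>!w. (w, v) \<in> A" by (rule ex1I)
  qed
  ultimately show ?thesis unfolding orientation_def by (intro exI[of _ A] conjI ballI) auto
qed

text \<open>Every cycle is oriented cyclically and the union of these orientations is taken. A cycle
  through \<open>v\<close> then contributes exactly one arc out of \<open>v\<close> and one into it,
  and edge-disjointness keeps the contributions of different cycles apart.\<close>

lemma cycle_decomposition_orientation:
  assumes k: "k \<ge> 3" and G: "simple_graph G"
    and D: "is_decomposition (cycle_graph k) G D"
  shows "\<exists>A. orientation G A \<and> (\<forall>v \<in> verts G.
    card (A `` {v}) = card {S \<in> D. v \<in> verts S} \<and> card (A\<inverse> `` {v}) = card {S \<in> D. v \<in> verts S})"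
proof -
  have S: "simple_graph S" "verts S \<subseteq> verts G" "edges S \<subseteq> edges G"
    "isomorphic S (cycle_graph k)" if "S \<in> D" for S
    using D that by (auto simp: is_decomposition_def subgraph_def)
  have disj: "S = S'" if "S \<in> D" "S' \<in> D" "e \<in> edges S" "e \<in> edges S'" for S S' e
    using D that unfolding is_decomposition_def disjoint_family_on_def by blast
  have cover: "edges G = (\<Union>S\<in>D. edges S)" using D by (simp add: is_decomposition_def)
  obtain B where B: "\<And>S. S \<in> D \<Longrightarrow> orientation S (B S)"
    "\<And>S v. S \<in> D \<Longrightarrow> v \<in> verts S \<Longrightarrow> \<exists>!w. (v, w) \<in> B S"
    "\<And>S v. S \<in> D \<Longrightarrow> v \<in> verts S \<Longrightarrow> \<exists>!w. (w, v) \<in> B S"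
  proof -
    have "\<forall>S \<in> D. \<exists>A. orientation S A \<and> (\<forall>v \<in> verts S. (\<exists>!w. (v, w) \<in> A) \<and> (\<exists>!w. (w, v) \<in> A))"
      using cycle_graph_orientation[OF k S(1,4)] by simp
    from bchoice[OF this] obtain B where B: "\<forall>S \<in> D. orientation S (B S) \<and>
      (\<forall>v \<in> verts S. (\<exists>!w. (v, w) \<in> B S) \<and> (\<exists>!w. (w, v) \<in> B S))" ..
    show ?thesis by (rule that[of B]) (use B in simp_all)
  qed
  have BS: "v \<in> verts S" "w \<in> verts S" "{v, w} \<in> edges S" "(w, v) \<notin> B S"
    if "S \<in> D" "(v, w) \<in> B S" for S v w
    using orientationD[OF B(1)[OF that(1)] that(2)]
      simple_graphD[OF S(1)[OF that(1)] orientationD(1)[OF B(1)[OF that(1)] that(2)]] by simp_all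
  define A where "A = (\<Union>S\<in>D. B S)"
  have "asym A"
    unfolding asym_iff
  proof (intro allI impI notI)
    fix v w assume "(v, w) \<in> A" "(w, v) \<in> A"
    then obtain S S' where SS: "S \<in> D" "(v, w) \<in> B S" "S' \<in> D" "(w, v) \<in> B S'"
      by (auto simp: A_def)
    have "S = S'"
      using disj[OF SS(1,3) BS(3)[OF SS(1,2)]] BS(3)[OF SS(3,4)] by (simp add: insert_commute)
    then show False using SS BS(4) by blast
  qed
  moreover have "edges G = {{v, w} | v w. (v, w) \<in> A}"
  proof -
    have "edges S = {{v, w} | v w. (v, w) \<in> B S}" if "S \<in> D" for S
      using B(1)[OF that] by (simp add: orientation_def)
    then have "edges G = (\<Union>S\<in>D. {{v, w} | v w. (v, w) \<in> B S})"
      unfolding cover by (rule SUP_cong[OF refl])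
    moreover have "\<dots> = {{v, w} | v w. (v, w) \<in> A}" unfolding A_def by auto
    ultimately show ?thesis by simp
  qed
  ultimately have "orientation G A" by (simp add: orientation_def)
  moreover have "card (A `` {v}) = card {S \<in> D. v \<in> verts S}" for v
  proof -
    \<comment> \<open>A cycle through \<open>v\<close> is sent to the head of its unique arc leaving
      \<open>v\<close>; two cycles with the same head would share an edge.\<close>
    have "bij_betw (\<lambda>S. THE w. (v, w) \<in> B S) {S \<in> D. v \<in> verts S} (A `` {v})"
    proof -
      have *: "(v, THE w. (v, w) \<in> B S) \<in> B S" if "S \<in> D" "v \<in> verts S" for S
        using theI'[OF B(2)[OF that]] .
      have "inj_on (\<lambda>S. THE w. (v, w) \<in> B S) {S \<in> D. v \<in> verts S}"
      proof (rule inj_onI)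
        fix S S' assume "S \<in> {S \<in> D. v \<in> verts S}" "S' \<in> {S \<in> D. v \<in> verts S}"
          and eq: "(THE w. (v, w) \<in> B S) = (THE w. (v, w) \<in> B S')"
        then have SS: "S \<in> D" "v \<in> verts S" "S' \<in> D" "v \<in> verts S'" by auto
        show "S = S'"
          using disj[OF SS(1,3) BS(3)[OF SS(1) *[OF SS(1,2)]]] BS(3)[OF SS(3) *[OF SS(3,4)]]
          by (simp add: eq)
      qed
      moreover have "(\<lambda>S. THE w. (v, w) \<in> B S) ` {S \<in> D. v \<in> verts S} = A `` {v}"
      proof (intro equalityI subsetI)
        fix w assume "w \<in> A `` {v}"
        then obtain T where T: "T \<in> D" "(v, w) \<in> B T" by (auto simp: A_def)
        then have "(THE w. (v, w) \<in> B T) = w" 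
          by (intro the1_equality[OF B(2)[OF T(1) BS(1)[OF T]] T(2)])
        then show "w \<in> (\<lambda>S. THE w. (v, w) \<in> B S) ` {S \<in> D. v \<in> verts S}" 
          using T BS(1)[OF T] by (intro image_eqI[of _ _ T]) auto
      qed (use * in \<open>auto simp: A_def\<close>)
      ultimately show ?thesis by (simp add: bij_betw_def)
    qed
    then show ?thesis by (simp add: bij_betw_same_card)
  qed
  moreover have "card (A\<inverse> `` {v}) = card {S \<in> D. v \<in> verts S}" for v
  proof -
    have "bij_betw (\<lambda>S. THE w. (w, v) \<in> B S) {S \<in> D. v \<in> verts S} (A\<inverse> `` {v})"
    proof -
      have *: "(THE w. (w, v) \<in> B S, v) \<in> B S" if "S \<in> D" "v \<in> verts S" for S
        using theI'[OF B(3)[OF that]] .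
      have "inj_on (\<lambda>S. THE w. (w, v) \<in> B S) {S \<in> D. v \<in> verts S}"
      proof (rule inj_onI)
        fix S S' assume "S \<in> {S \<in> D. v \<in> verts S}" "S' \<in> {S \<in> D. v \<in> verts S}"
          and eq: "(THE w. (w, v) \<in> B S) = (THE w. (w, v) \<in> B S')"
        then have SS: "S \<in> D" "v \<in> verts S" "S' \<in> D" "v \<in> verts S'" by auto
        show "S = S'"
          using disj[OF SS(1,3) BS(3)[OF SS(1) *[OF SS(1,2)]]] BS(3)[OF SS(3) *[OF SS(3,4)]]
          by (simp add: eq)
      qed
      moreover have "(\<lambda>S. THE w. (w, v) \<in> B S) ` {S \<in> D. v \<in> verts S} = A\<inverse> `` {v}"
      proof (intro equalityI subsetI)
        fix w assume "w \<in> A\<inverse> `` {v}"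
        then obtain T where T: "T \<in> D" "(w, v) \<in> B T" by (auto simp: A_def)
        then have "(THE w. (w, v) \<in> B T) = w" 
          by (intro the1_equality[OF B(3)[OF T(1) BS(2)[OF T]] T(2)])
        then show "w \<in> (\<lambda>S. THE w. (w, v) \<in> B S) ` {S \<in> D. v \<in> verts S}" 
          using T BS(2)[OF T] by (intro image_eqI[of _ _ T]) auto
      qed (use * in \<open>auto simp: A_def\<close>)
      ultimately show ?thesis by (simp add: bij_betw_def)
    qed
    then show ?thesis by (simp add: bij_betw_same_card)
  qed
  ultimately show ?thesis by blast
qed

section \<open>Cartesian powers of a graph\<close>

text \<open>With vertices as lists, the copy of \<open>G\<close> through \<open>xs\<close> in
  direction \<open>j\<close> consists of the lists \<open>xs[j := u]\<close>, and any of its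
  vertices may stand for \<open>xs\<close>.\<close>

definition power_graph :: "nat \<Rightarrow> 'a graph \<Rightarrow> 'a list graph" where
  "power_graph m G = \<lparr>verts = {xs. length xs = m \<and> set xs \<subseteq> verts G},
     edges = {{xs, xs[j := w]} | xs j w.
       length xs = m \<and> set xs \<subseteq> verts G \<and> j < m \<and> {xs ! j, w} \<in> edges G}\<rparr>"

lemma in_verts_power_graph:
  "xs \<in> verts (power_graph m G) \<longleftrightarrow> length xs = m \<and> set xs \<subseteq> verts G"
  by (simp add: power_graph_def)

lemma edges_power_graph:
  "edges (power_graph m G) = {{xs, xs[j := w]} | xs j w.
     xs \<in> verts (power_graph m G) \<and> j < m \<and> {xs ! j, w} \<in> edges G}"
  by (auto simp: power_graph_def)

lemma list_update_in_verts_power_graph: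
  assumes "xs \<in> verts (power_graph m G)" "u \<in> verts G"
  shows "xs[j := u] \<in> verts (power_graph m G)"
  using assms by (auto simp: in_verts_power_graph dest: set_update_subset_insert[THEN subsetD])

lemma list_update_neq_self: "j < length xs \<Longrightarrow> w \<noteq> xs ! j \<Longrightarrow> xs[j := w] \<noteq> xs"
  by (metis nth_list_update_eq)

lemma simple_graph_power_graph:
  assumes G: "simple_graph G"
  shows "simple_graph (power_graph m G)"
  unfolding simple_graph_def
proof
  fix e assume "e \<in> edges (power_graph m G)"
  then obtain xs j w where e: "e = {xs, xs[j := w]}" "xs \<in> verts (power_graph m G)"
    "j < m" "{xs ! j, w} \<in> edges G"
    by (auto simp: edges_power_graph)
  have "xs[j := w] \<noteq> xs"
    using e simple_graphD[OF G e(4)] by (intro list_update_neq_self) (auto simp: in_verts_power_graph)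
  then show "e \<subseteq> verts (power_graph m G) \<and> card e = 2"
    using e simple_graphD[OF G e(4)] by (auto simp: list_update_in_verts_power_graph card_2_iff)
qed

text \<open>The ends differ in a single coordinate, so an edge of the power determines its
  direction, and its ends up to exchange.\<close>

lemma list_update_pair_eqD:
  assumes eq: "{xs, xs[j := w]} = {ys, ys[i := z]}"
    and "j < length xs" "i < length ys" "w \<noteq> xs ! j" "z \<noteq> ys ! i"
  shows "i = j \<and> (ys = xs \<and> z = w \<or> ys = xs[j := w] \<and> z = xs ! j)"
proof (cases "ys = xs")
  case True
  then have "xs[j := w] = xs[i := z]" using eq by (auto simp: doubleton_eq_iff)
  then show ?thesis using True assms by (metis nth_list_update)
next
  case False
  then have "ys = xs[j := w]" "ys[i := z] = xs" using eq by (auto simp: doubleton_eq_iff)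
  then show ?thesis using assms by (metis nth_list_update)
qed

text \<open>Makes every decomposition of a finite graph finite, so that the copies through a vertex
  can be counted.\<close>

lemma finite_subgraphs:
  assumes "finite (verts G)" "simple_graph G"
  shows "finite {S. subgraph S G}"
proof -
  have "edges G \<subseteq> Pow (verts G)" using assms(2) by (auto simp: simple_graph_def)
  then have fin: "finite (edges G)" using assms(1) by (auto intro: finite_subset)
  have "{S. subgraph S G} \<subseteq> (\<lambda>(V, E). \<lparr>verts = V, edges = E\<rparr>) ` (Pow (verts G) \<times> Pow (edges G))"
  proof
    fix S :: "'a graph" assume "S \<in> {S. subgraph S G}"
    then have "(verts S, edges S) \<in> Pow (verts G) \<times> Pow (edges G)" by (auto simp: subgraph_def)
    moreover have "S = (\<lambda>(V, E). \<lparr>verts = V, edges = E\<rparr>) (verts S, edges S)" by simp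
    ultimately show "S \<in> (\<lambda>(V, E). \<lparr>verts = V, edges = E\<rparr>) ` (Pow (verts G) \<times> Pow (edges G))"
      by blast
  qed
  then show ?thesis using assms(1) fin by (auto intro: finite_subset)
qed


section \<open>Powers in which some copies of the graph are cut and the others oriented\<close>

lemma map_graph_comp: "map_graph f (map_graph g G) = map_graph (f \<circ> g) G"
  by (simp add: map_graph_def image_comp comp_def)

lemma map_graph_ident: "(\<And>x. f x = x) \<Longrightarrow> map_graph f G = G"
  by (simp add: map_graph_def)

text \<open>\<open>T xs j\<close> says that the copy of \<open>G\<close> through \<open>xs\<close> in direction \<open>j\<close> is cut into copies of \<open>H\<close>;
  otherwise that copy is oriented by \<open>R xs j\<close>.\<close>

lemma power_graph_decomposition:
  fixes G :: "'a graph" and H :: "'b graph" and T :: "'a list \<Rightarrow> nat \<Rightarrow> bool" and R :: "'a list \<Rightarrow> nat \<Rightarrow> 'a rel"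
  assumes G: "simple_graph G" "finite (verts G)" and H: "simple_graph H" "edges H \<noteq> {}"
    and D: "is_decomposition H G D"
    and T_upd: "\<And>xs j u. T (xs[j := u]) j = T xs j"
    and R_upd: "\<And>xs j u. R (xs[j := u]) j = R xs j"
    and R: "\<And>xs j. xs \<in> verts (power_graph m G) \<Longrightarrow> j < m \<Longrightarrow> \<not> T xs j \<Longrightarrow> orientation G (R xs j)"
    and count: "\<And>xs. xs \<in> verts (power_graph m G) \<Longrightarrow>
      (\<Sum>j | j < m \<and> T xs j. card {S \<in> D. xs ! j \<in> verts S}) =
      (\<Sum>j | j < m \<and> \<not> T xs j. card (R xs j `` {xs ! j}))"
  shows "has_decomposition (attach_pendants H) (power_graph m G)"
proof -
  let ?V = "verts (power_graph m G)"
  have S: "simple_graph S" "verts S \<subseteq> verts G" "edges S \<subseteq> edges G" "isomorphic S H" if "S \<in> D" for S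
    using D that by (auto simp: is_decomposition_def subgraph_def)
  have disj: "S = S'" if "S \<in> D" "S' \<in> D" "e \<in> edges S" "e \<in> edges S'" for S S' e
    using D that unfolding is_decomposition_def disjoint_family_on_def by blast
  have cover: "edges G = (\<Union>S\<in>D. edges S)" using D by (simp add: is_decomposition_def)
  \<comment> \<open>A one-vertex copy would not reveal the direction in which it lies; two vertices
    are what \<open>copy_eqD\<close> relies on.\<close>
  have ne: "\<exists>u v. u \<in> verts S \<and> v \<in> verts S \<and> u \<noteq> v" if "S \<in> D" for S
  proof -
    from isomorphic_sym[OF S(4)[OF that]] obtain g where g: "bij_betw g (verts H) (verts S)"
      by (auto simp: isomorphic_def)
    obtain e where "e \<in> edges H" using H(2) by auto
    then obtain a b where ab: "a \<in> verts H" "b \<in> verts H" "a \<noteq> b"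
      using H(1) by (metis simple_graph_edgeE)
    then have "g a \<in> verts S" "g b \<in> verts S" "g a \<noteq> g b"
      using g by (auto simp: bij_betw_def inj_on_def)
    then show ?thesis by blast
  qed
  have finD: "finite D"
    using D by (intro finite_subset[OF _ finite_subgraphs[OF G(2,1)]]) (auto simp: is_decomposition_def)
  have len: "length xs = m" if "xs \<in> ?V" for xs using that by (simp add: in_verts_power_graph)

  \<comment> \<open>Coordinate \<open>j\<close> of \<open>xs\<close> is overwritten, so any vertex
    of the copy can replace \<open>xs\<close>. \<open>T_upd\<close> and \<open>R_upd\<close> say the
    same of \<open>T\<close> and \<open>R\<close>, which allows a change of base point in all
    arguments below.\<close>
  define copy where "copy xs j S = map_graph (\<lambda>u. xs[j := u]) S" for xs :: "'a list" and j S
  have copy_upd: "copy (xs[j := u]) j S = copy xs j S" for xs j u S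
    by (simp add: copy_def)
  have inj_upd: "inj_on (\<lambda>u. xs[j := u]) A" if "xs \<in> ?V" "j < m" for xs j A
    using that len by (intro inj_onI) (metis nth_list_update_eq)
  define C where "C = {copy xs j S | xs j S. xs \<in> ?V \<and> j < m \<and> T xs j \<and> S \<in> D}"

  \<comment> \<open>The copy is rebased at its own vertex \<open>ys\<close>.\<close>
  have C_vert: "\<exists>j S. j < m \<and> T ys j \<and> S \<in> D \<and> S' = copy ys j S \<and> ys \<in> ?V \<and> ys ! j \<in> verts S"
    if "S' \<in> C" "ys \<in> verts S'" for S' ys
  proof -
    from that(1) obtain xs j S where *: "S' = copy xs j S" "xs \<in> ?V" "j < m" "T xs j" "S \<in> D"
      by (auto simp: C_def)
    from that(2) * obtain u where u: "u \<in> verts S" "ys = xs[j := u]" by (auto simp: copy_def)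
    have "u \<in> verts G" using u * S(2) by auto
    then have "ys \<in> ?V" using u * by (simp add: list_update_in_verts_power_graph)
    moreover have "ys ! j = u" using u * len by simp
    moreover have "T ys j" "S' = copy ys j S" using u * by (simp_all add: T_upd copy_upd)
    ultimately show ?thesis using * u by blast
  qed
  have C_edge: "\<exists>ys j w S. e = {ys, ys[j := w]} \<and> ys \<in> ?V \<and> j < m \<and> T ys j \<and> S \<in> D \<and>
      S' = copy ys j S \<and> {ys ! j, w} \<in> edges S" if "S' \<in> C" "e \<in> edges S'" for S' e
  proof -
    from that(1) obtain xs j S where *: "S' = copy xs j S" "xs \<in> ?V" "j < m" "T xs j" "S \<in> D"
      by (auto simp: C_def)
    from that(2) * obtain d where d: "d \<in> edges S" "e = (\<lambda>u. xs[j := u]) ` d" by (auto simp: copy_def)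
    obtain u w where uw: "d = {u, w}" "u \<in> verts S" using S(1)[OF *(5)] d(1) by (metis simple_graph_edgeE)
    let ?ys = "xs[j := u]"
    have "u \<in> verts G" using uw * S(2) by auto
    then have "?ys \<in> ?V" using * by (simp add: list_update_in_verts_power_graph)
    moreover have "?ys ! j = u" using * len by simp
    moreover have "T ?ys j" "S' = copy ?ys j S" using * by (simp_all add: T_upd copy_upd)
    moreover have "e = {?ys, ?ys[j := w]}" using d uw by simp
    moreover have "{?ys ! j, w} \<in> edges S" using d uw * len by simp
    ultimately show ?thesis using * by blast
  qed
  have upd_pair: "i = j \<and> (ys = xs \<and> z = w \<or> ys = xs[j := w] \<and> z = xs ! j)"
    if "{xs, xs[j := w]} = {ys, ys[i := z]}" "xs \<in> ?V" "ys \<in> ?V" "j < m" "i < m"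
      "{xs ! j, w} \<in> edges G" "{ys ! i, z} \<in> edges G" for xs ys i j w z
    using that len simple_graphD(3)[OF G(1)]
    by (intro list_update_pair_eqD) (auto dest: sym)
  \<comment> \<open>A vertex that differs from \<open>xs\<close> in coordinate \<open>j\<close>
    reveals the direction; projection to that coordinate then recovers the subgraph.\<close>
  have copy_eqD: "i = j \<and> S' = S"
    if eq: "copy xs j S = copy xs i S'" and *: "xs \<in> ?V" "j < m" "i < m" "S \<in> D" "S' \<in> D" for xs i j S S'
  proof -
    have "i = j"
    proof (rule ccontr)
      assume ij: "i \<noteq> j"
      obtain u where u: "u \<in> verts S" "u \<noteq> xs ! j" using ne[OF *(4)] by metis
      then have "xs[j := u] \<in> verts (copy xs i S')" unfolding eq[symmetric] by (simp add: copy_def)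
      then obtain z where "xs[j := u] = xs[i := z]" by (auto simp: copy_def)
      then have "xs[j := u] ! j = xs[i := z] ! j" by simp
      then show False using u ij * len by simp
    qed
    moreover have "map_graph (\<lambda>ys. ys ! j) (copy xs j X) = X" for X
      unfolding copy_def map_graph_comp using * len by (intro map_graph_ident) simp
    ultimately show ?thesis using eq by metis
  qed

  define A where "A = {(xs, xs[j := w]) | xs j w. xs \<in> ?V \<and> j < m \<and> \<not> T xs j \<and> (xs ! j, w) \<in> R xs j}"
  have A_E: "\<exists>j w. ys = xs[j := w] \<and> xs \<in> ?V \<and> j < m \<and> \<not> T xs j \<and> (xs ! j, w) \<in> R xs j \<and>
     {xs ! j, w} \<in> edges G \<and> w \<noteq> xs ! j" if "(xs, ys) \<in> A" for xs ys
  proof -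
    from that obtain j w where *: "ys = xs[j := w]" "xs \<in> ?V" "j < m" "\<not> T xs j" "(xs ! j, w) \<in> R xs j"
      by (auto simp: A_def)
    then show ?thesis using orientationD[OF R[OF *(2,3,4)] *(5)] by blast
  qed

  show ?thesis
  proof (rule attach_pendants_decomposition[where C = C and A = A])
    show "simple_graph (power_graph m G)" by (rule simple_graph_power_graph) fact
    show "simple_graph H" by fact
  next
    fix S' assume S': "S' \<in> C"
    then obtain xs j S where *: "S' = copy xs j S" "xs \<in> ?V" "j < m" "T xs j" "S \<in> D"
      by (auto simp: C_def)
    have simp: "simple_graph S'"
      unfolding * copy_def by (rule simple_graph_map_graph) (use * S inj_upd in auto)
    have "verts S' \<subseteq> ?V" using C_vert[OF S'] by blast
    moreover have "edges S' \<subseteq> edges (power_graph m G)"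
    proof
      fix e assume "e \<in> edges S'"
      from C_edge[OF S' this] obtain ys j w S where "e = {ys, ys[j := w]}" "ys \<in> ?V" "j < m"
        "S \<in> D" "{ys ! j, w} \<in> edges S" by blast
      then show "e \<in> edges (power_graph m G)" using S(3) unfolding edges_power_graph by blast
    qed
    ultimately show "subgraph S' (power_graph m G)" using simp by (simp add: subgraph_def)
    have "isomorphic S S'"
      unfolding * copy_def by (rule isomorphic_map_graph) (use * S inj_upd in auto)
    then show "isomorphic S' H" using S(4)[OF *(5)] isomorphic_sym isomorphic_trans by metis
  next
    have "S1 = S2" if C12: "S1 \<in> C" "S2 \<in> C" and e: "e \<in> edges S1" "e \<in> edges S2" for S1 S2 e
    proof -
      from C_edge[OF C12(1) e(1)] obtain ys j w S where 1: "e = {ys, ys[j := w]}" "ys \<in> ?V" "j < m"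
        "S \<in> D" "S1 = copy ys j S" "{ys ! j, w} \<in> edges S" by blast
      from C_edge[OF C12(2) e(2)] obtain zs i x S' where 2: "e = {zs, zs[i := x]}" "zs \<in> ?V" "i < m"
        "S' \<in> D" "S2 = copy zs i S'" "{zs ! i, x} \<in> edges S'" by blast
      have "i = j \<and> (zs = ys \<and> x = w \<or> zs = ys[j := w] \<and> x = ys ! j)"
        using 1 2 S(3) by (intro upd_pair) blast+
      then have ij: "i = j" and or: "zs = ys \<and> x = w \<or> zs = ys[j := w] \<and> x = ys ! j" by blast+
      \<comment> \<open>Projected to direction \<open>j\<close>, the common edge lies in both
        \<open>S\<close> and \<open>S'\<close>, which therefore coincide.\<close>
      from or have "{zs ! i, x} = {ys ! j, w}" using 1 len ij by auto
      then have "S = S'" using disj 1 2 by metis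
      moreover have "copy zs j S' = copy ys j S'" using or copy_upd by auto
      ultimately show ?thesis using 1 2 ij by simp
    qed
    then show "disjoint_family_on edges C" unfolding disjoint_family_on_def by blast
  next
    have "asym A"
      unfolding asym_iff
    proof (intro allI impI notI)
      fix xs ys assume 1: "(xs, ys) \<in> A" and 2: "(ys, xs) \<in> A"
      from A_E[OF 1] obtain j w where j: "ys = xs[j := w]" "xs \<in> ?V" "j < m" "\<not> T xs j"
        "(xs ! j, w) \<in> R xs j" "{xs ! j, w} \<in> edges G" "w \<noteq> xs ! j" by blast
      from A_E[OF 2] obtain i z where i: "xs = ys[i := z]" "ys \<in> ?V" "i < m"
        "(ys ! i, z) \<in> R ys i" "{ys ! i, z} \<in> edges G" by blast
      have "{xs, xs[j := w]} = {ys, ys[i := z]}" using i(1) j(1) by auto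
      from upd_pair[OF this j(2) i(2) j(3) i(3) j(6) i(5)] have "i = j" "ys = xs[j := w]" "z = xs ! j"
        using j by (auto simp: list_update_neq_self len)
      then have "(w, xs ! j) \<in> R xs j" using i(4) j(2,3) len R_upd by simp
      then show False using orientationD(2)[OF R[OF j(2,3,4)] j(5)] by blast
    qed
    moreover have "edges (power_graph m G) - (\<Union>S\<in>C. edges S) = {{v, w} | v w. (v, w) \<in> A}"
    proof (intro equalityI subsetI)
      fix e assume e: "e \<in> edges (power_graph m G) - (\<Union>S\<in>C. edges S)"
      then obtain xs j w where *: "e = {xs, xs[j := w]}" "xs \<in> ?V" "j < m" "{xs ! j, w} \<in> edges G"
        unfolding edges_power_graph by blast
      have nT: "\<not> T xs j"
      proof
        assume T: "T xs j"
        obtain S where S: "S \<in> D" "{xs ! j, w} \<in> edges S" using cover *(4) by blast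
        from S(2) have "(\<lambda>u. xs[j := u]) ` {xs ! j, w} \<in> edges (copy xs j S)"
          unfolding copy_def edges_map_graph by (rule imageI)
        then have "e \<in> edges (copy xs j S)" using * by simp
        moreover have "copy xs j S \<in> C" using * T S by (auto simp: C_def)
        ultimately show False using e by blast
      qed
      from orientation_edge[OF R[OF *(2,3) nT] *(4)] show "e \<in> {{v, w} | v w. (v, w) \<in> A}"
      proof
        assume "(xs ! j, w) \<in> R xs j"
        then have "(xs, xs[j := w]) \<in> A" using * nT unfolding A_def by blast
        then show ?thesis using *(1) by blast
      next
        \<comment> \<open>The arc points towards \<open>xs\<close>, so it is recorded at the other
          end \<open>?ys\<close>, where \<open>T\<close> and \<open>R\<close> in direction
          \<open>j\<close> are the same.\<close>
        assume a: "(w, xs ! j) \<in> R xs j"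
        let ?ys = "xs[j := w]"
        have w: "?ys ! j = w" using * len by simp
        have "(?ys ! j, xs ! j) \<in> R ?ys j" using a w R_upd by simp
        moreover have "?ys \<in> ?V"
          using * simple_graphD[OF G(1) *(4)] by (simp add: list_update_in_verts_power_graph)
        ultimately have "(?ys, ?ys[j := xs ! j]) \<in> A" using *(3) nT T_upd unfolding A_def by blast
        then have "(?ys, xs) \<in> A" by simp
        then show ?thesis using *(1) by (auto simp: insert_commute)
      qed
    next
      fix e assume "e \<in> {{v, w} | v w. (v, w) \<in> A}"
      then obtain xs ys where e: "e = {xs, ys}" "(xs, ys) \<in> A" by blast
      from A_E[OF e(2)] obtain j w where j: "ys = xs[j := w]" "xs \<in> ?V" "j < m" "\<not> T xs j"
        "{xs ! j, w} \<in> edges G" by blast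
      have "e \<in> edges (power_graph m G)" using e j unfolding edges_power_graph by blast
      moreover have "e \<notin> edges S'" if S': "S' \<in> C" for S'
      proof
        assume "e \<in> edges S'"
        from C_edge[OF S' this] obtain zs i x S where 2: "e = {zs, zs[i := x]}" "zs \<in> ?V" "i < m"
          "T zs i" "S \<in> D" "{zs ! i, x} \<in> edges S" by blast
        have "i = j \<and> (zs = xs \<and> x = w \<or> zs = xs[j := w] \<and> x = xs ! j)"
          using e j 2 S(3) by (intro upd_pair) blast+
        then have "T xs j" using 2(4) T_upd by metis
        then show False using j by simp
      qed
      ultimately show "e \<in> edges (power_graph m G) - (\<Union>S\<in>C. edges S)" by blast
    qed
    ultimately show "orientation \<lparr>verts = ?V, edges = edges (power_graph m G) - (\<Union>S\<in>C. edges S)\<rparr> A"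
      by (simp add: orientation_def)
  next
    fix xs assume xs: "xs \<in> ?V"
    \<comment> \<open>\<open>?I\<close> encodes the copies through \<open>xs\<close> as pairs of a
      cut direction and a subgraph, \<open>?J\<close> the arcs leaving \<open>xs\<close> as pairs of
      an oriented direction and a head. Their sizes are the two sides of
      \<open>count\<close>.\<close>
    let ?I = "SIGMA j:{j. j < m \<and> T xs j}. {S \<in> D. xs ! j \<in> verts S}"
    let ?J = "SIGMA j:{j. j < m \<and> \<not> T xs j}. R xs j `` {xs ! j}"
    have C_eq: "{S' \<in> C. xs \<in> verts S'} = (\<lambda>(j, S). copy xs j S) ` ?I"
    proof (intro equalityI subsetI)
      fix S' assume "S' \<in> {S' \<in> C. xs \<in> verts S'}"
      then obtain j S where "j < m" "T xs j" "S \<in> D" "S' = copy xs j S" "xs ! j \<in> verts S"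
        using C_vert by blast
      then show "S' \<in> (\<lambda>(j, S). copy xs j S) ` ?I" by (intro image_eqI[of _ _ "(j, S)"]) auto
    next
      fix S' assume "S' \<in> (\<lambda>(j, S). copy xs j S) ` ?I"
      then obtain j S where *: "j < m" "T xs j" "S \<in> D" "S' = copy xs j S" "xs ! j \<in> verts S"
        by auto
      have "xs[j := xs ! j] \<in> verts S'" unfolding *(4) copy_def verts_map_graph using *(5) by (rule imageI)
      then show "S' \<in> {S' \<in> C. xs \<in> verts S'}" using * xs unfolding C_def by auto
    qed
    have C_inj: "inj_on (\<lambda>(j, S). copy xs j S) ?I"
    proof (rule inj_onI)
      fix a b assume ab: "a \<in> ?I" "b \<in> ?I"
        "(\<lambda>(j, S). copy xs j S) a = (\<lambda>(j, S). copy xs j S) b"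
      obtain j S i S' where a: "a = (j, S)" "b = (i, S')" by (cases a, cases b)
      have "i = j \<and> S' = S" using ab xs unfolding a by (intro copy_eqD[of xs]) auto
      then show "a = b" by (simp add: a)
    qed
    have A_eq: "A `` {xs} = (\<lambda>(j, w). xs[j := w]) ` ?J"
    proof (intro equalityI subsetI)
      fix ys assume "ys \<in> A `` {xs}"
      then have "(xs, ys) \<in> A" by simp
      from A_E[OF this] obtain j w where "ys = xs[j := w]" "j < m" "\<not> T xs j"
        "(xs ! j, w) \<in> R xs j" by blast
      then show "ys \<in> (\<lambda>(j, w). xs[j := w]) ` ?J" by (intro image_eqI[of _ _ "(j, w)"]) auto
    next
      fix ys assume "ys \<in> (\<lambda>(j, w). xs[j := w]) ` ?J"
      then obtain j w where "ys = xs[j := w]" "j < m" "\<not> T xs j" "(xs ! j, w) \<in> R xs j" by auto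
      then show "ys \<in> A `` {xs}" using xs unfolding A_def by blast
    qed
    have A_inj: "inj_on (\<lambda>(j, w). xs[j := w]) ?J"
    proof (rule inj_onI)
      fix a b assume ab: "a \<in> ?J" "b \<in> ?J" "(\<lambda>(j, w). xs[j := w]) a = (\<lambda>(j, w). xs[j := w]) b"
      obtain j w i z where a: "a = (j, w)" "b = (i, z)" by (cases a, cases b)
      have j: "j < m" "\<not> T xs j" "(xs ! j, w) \<in> R xs j" and i: "i < m" "\<not> T xs i" "(xs ! i, z) \<in> R xs i"
        and eq: "xs[j := w] = xs[i := z]" using ab by (auto simp: a)
      have "i = j \<and> (xs = xs \<and> z = w \<or> xs = xs[j := w] \<and> z = xs ! j)"
        using eq j i xs orientationD(1)[OF R[OF xs j(1,2)] j(3)] orientationD(1)[OF R[OF xs i(1,2)] i(3)]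
        by (intro upd_pair) simp_all
      moreover have "xs[j := w] \<noteq> xs"
        using orientationD(3)[OF R[OF xs j(1,2)] j(3)] j xs len by (intro list_update_neq_self) auto
      ultimately show "a = b" using a by simp
    qed
    have fin: "finite (R xs j `` {xs ! j})" if "j < m" "\<not> T xs j" for j
    proof (rule finite_subset[OF _ G(2)])
      show "R xs j `` {xs ! j} \<subseteq> verts G"
        using orientationD(1)[OF R[OF xs that]] simple_graphD(2)[OF G(1)] by blast
    qed
    have finI: "finite ?I" using finD by (intro finite_SigmaI) auto
    then show "finite {S' \<in> C. xs \<in> verts S'}" unfolding C_eq by (rule finite_imageI)
    have finJ: "finite ?J" using fin by (intro finite_SigmaI) auto
    then show "finite (A `` {xs})" unfolding A_eq by (rule finite_imageI)
    have "card {S' \<in> C. xs \<in> verts S'} = card ?I" unfolding C_eq by (rule card_image) fact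
    also have "\<dots> = (\<Sum>j | j < m \<and> T xs j. card {S \<in> D. xs ! j \<in> verts S})"
      using finD by (intro card_SigmaI) auto
    also have "\<dots> = (\<Sum>j | j < m \<and> \<not> T xs j. card (R xs j `` {xs ! j}))" using xs by (rule count)
    also have "\<dots> = card ?J" using fin by (intro card_SigmaI[symmetric]) auto
    also have "\<dots> = card (A `` {xs})" unfolding A_eq by (rule card_image[symmetric]) fact
    finally show "card {S' \<in> C. xs \<in> verts S'} = card (A `` {xs})" .
  next
    fix S' xs ys assume S': "S' \<in> C" "xs \<in> verts S'" and A: "(xs, ys) \<in> A"
    from C_vert[OF S'] obtain j S where j: "j < m" "T xs j" "S' = copy xs j S" "xs \<in> ?V" by blast
    from A_E[OF A] obtain i w where i: "ys = xs[i := w]" "i < m" "\<not> T xs i" "w \<noteq> xs ! i" by blast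
    \<comment> \<open>Vertices of \<open>S'\<close> agree with \<open>xs\<close> off the cut
      direction \<open>j\<close>, whereas the arc changes coordinate \<open>i\<close>, an oriented
      direction and hence different from \<open>j\<close>.\<close>
    show "ys \<notin> verts S'"
    proof
      assume "ys \<in> verts S'"
      then obtain u where "ys = xs[j := u]" using j by (auto simp: copy_def)
      moreover have "i \<noteq> j" using i j by auto
      ultimately have "ys ! i = xs ! i" by simp
      then show False using i j len by simp
    qed
  next
    fix S' xs xs' ys assume S': "S' \<in> C" and v: "xs \<in> verts S'" "xs' \<in> verts S'"
      and A: "(xs, ys) \<in> A" "(xs', ys) \<in> A"
    from C_vert[OF S' v(1)] obtain j S where j: "j < m" "T xs j" "S' = copy xs j S" "xs \<in> ?V" by blast
    then obtain u where u: "xs' = xs[j := u]" using v by (auto simp: copy_def)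
    from A_E[OF A(1)] obtain i w where i: "ys = xs[i := w]" "\<not> T xs i" by blast
    from A_E[OF A(2)] obtain l z where l: "ys = xs'[l := z]" "\<not> T xs' l" by blast
    \<comment> \<open>\<open>xs\<close> and \<open>xs'\<close> can differ only in coordinate
      \<open>j\<close>. Neither arc changes that coordinate and both end at \<open>ys\<close>, so
      they agree there as well.\<close>
    have "i \<noteq> j" "l \<noteq> j" using i l j u T_upd by auto
    then have "xs ! j = ys ! j" "xs' ! j = ys ! j" using i(1) l(1) by (metis nth_list_update_neq)+
    moreover have "xs' ! j = u" using u j len by simp
    ultimately have "xs ! j = u" by simp
    then show "xs = xs'" using u by auto
  qed
qed


section \<open>Sunlet decompositions of powers of regular bipartite graphs\<close>

text \<open>Each edge at \<open>v\<close> is either an outgoing or an incoming arc, never both.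
  Applied to the orientation along the cycles, this shows that the degree is twice the number of
  cycles through a vertex.\<close>

lemma orientation_degree:
  assumes A: "orientation G A" and fin: "finite (verts G)" and G: "simple_graph G"
  shows "card {w. {v, w} \<in> edges G} = card (A `` {v}) + card (A\<inverse> `` {v})"
proof -
  have "{v, w} \<in> edges G \<longleftrightarrow> (v, w) \<in> A \<or> (w, v) \<in> A" for w
    using orientationD(1)[OF A] orientation_edge[OF A] by (metis insert_commute)
  then have eq: "{w. {v, w} \<in> edges G} = A `` {v} \<union> A\<inverse> `` {v}" by auto
  have "finite {w. {v, w} \<in> edges G}"
    by (rule finite_subset[OF _ fin]) (auto dest: simple_graphD[OF G])
  moreover have "A `` {v} \<inter> A\<inverse> `` {v} = {}"
    using orientationD(2)[OF A] by auto
  ultimately show ?thesis unfolding eq by (intro card_Un_disjoint) auto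
qed

text \<open>The hypercube is abstracted to a finite simple regular graph with a proper 2-colouring;
  \<open>col\<close> stands for the parity of a block.\<close>

lemma sunlet_decomposition_power_graph:
  fixes G :: "'a graph" and col :: "'a \<Rightarrow> bool"
  assumes k: "k \<ge> 3" and G: "simple_graph G" "finite (verts G)"
    and dec: "has_decomposition (cycle_graph k) G"
    and regular: "\<And>v. v \<in> verts G \<Longrightarrow> card {w. {v, w} \<in> edges G} = d"
    and col: "\<And>u v. {u, v} \<in> edges G \<Longrightarrow> col u \<noteq> col v"
    and m: "m \<ge> 2"
  shows "has_decomposition (sunlet_graph k) (power_graph m G)"
proof -
  from dec obtain D where D: "is_decomposition (cycle_graph k) G D"
    by (auto simp: has_decomposition_def)
  from cycle_decomposition_orientation[OF k G(1) D] obtain E where E: "orientation G E"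
    and E_card: "\<And>v. v \<in> verts G \<Longrightarrow> card (E `` {v}) = card {S \<in> D. v \<in> verts S}"
      "\<And>v. v \<in> verts G \<Longrightarrow> card (E\<inverse> `` {v}) = card {S \<in> D. v \<in> verts S}"
    by blast
  define r where "r = d div 2"
  have r: "card {S \<in> D. v \<in> verts S} = r" "d = 2 * r" if "v \<in> verts G" for v
    using orientation_degree[OF E G(2,1), of v] E_card[OF that] regular[OF that]
    by (simp_all add: r_def)
  \<comment> \<open>The first \<open>s\<close> directions form the parity triple, empty for even
    \<open>m\<close>; the other \<open>2 * q\<close> directions are paired. An odd
    \<open>m \<ge> 2\<close> is at least 3, so the triple fits.\<close>
  obtain s q where s: "s = 0 \<or> s = 3" "m = s + 2 * q"
  proof (cases "even m")
    case True
    then show ?thesis using that[of 0 "m div 2"] by simp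
  next
    case False
    then have "m = 3 + 2 * ((m - 3) div 2)" using m by presburger
    then show ?thesis using that[of 3] by blast
  qed
  \<comment> \<open>In the triple, a copy is cut if the other two blocks have different colours.
    Beyond it, the directions are cut and oriented alternately, starting with a cut at
    \<open>s\<close>.\<close>
  define T where "T xs j = (if j < s then col (xs ! (Suc j mod 3)) \<noteq> col (xs ! ((j + 2) mod 3))
    else even (j - s))" for xs :: "'a list" and j
  \<comment> \<open>In an oriented copy of the triple the other two blocks share their colour, so
    block \<open>Suc j mod 3\<close> alone determines the target colour.\<close>
  define R where "R xs j = (if j < s then {(u, w). {u, w} \<in> edges G \<and> col w = col (xs ! (Suc j mod 3))}
    else E)" for xs :: "'a list" and j
  \<comment> \<open>The blocks consulted for a direction \<open>j\<close> in the triple never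
    include block \<open>j\<close> itself, which yields both update conditions.\<close>
  have ne: "Suc j mod 3 \<noteq> j" "(j + 2) mod 3 \<noteq> j" for j
    by presburger+
  have "has_decomposition (attach_pendants (cycle_graph k)) (power_graph m G)"
  proof (rule power_graph_decomposition[OF G _ _ D])
    show "simple_graph (cycle_graph k)" using k by (rule simple_graph_cycle_graph)
    have "{0, Suc 0 mod k} \<in> edges (cycle_graph k)"
      using k unfolding cycle_graph_def by (simp, intro exI[of _ 0]) simp
    then show "edges (cycle_graph k) \<noteq> {}" by blast
    show "T (xs[j := u]) j = T xs j" for xs j u
      unfolding T_def by (simp only: nth_list_update_neq[OF ne(1)[symmetric]] nth_list_update_neq[OF ne(2)[symmetric]])
    show "R (xs[j := u]) j = R xs j" for xs j u
      unfolding R_def by (simp only: nth_list_update_neq[OF ne(1)[symmetric]])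
    show "orientation G (R xs j)" for xs j
    proof (cases "j < s")
      case False
      then show ?thesis using E by (simp add: R_def)
    next
      case True
      define c where "c = col (xs ! (Suc j mod 3))"
      \<comment> \<open>Exactly one end of each edge has colour \<open>c\<close>, so pointing every
        edge towards that end is an orientation.\<close>
      define B where "B = {(u, w). {u, w} \<in> edges G \<and> col w = c}"
      have "edges G = {{u, w} | u w. (u, w) \<in> B}"
      proof (intro equalityI subsetI)
        fix e assume e: "e \<in> edges G"
        then obtain u w where uw: "e = {u, w}" using G(1) by (metis simple_graph_edgeE)
        then have wu: "e = {w, u}" by (simp add: insert_commute)
        have "col w \<noteq> col u" using col e wu by simp
        then have "(u, w) \<in> B \<or> (w, u) \<in> B" using e uw wu by (auto simp: B_def)
        then show "e \<in> {{u, w} | u w. (u, w) \<in> B}" using uw wu by blast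
      next
        fix e assume "e \<in> {{u, w} | u w. (u, w) \<in> B}"
        then show "e \<in> edges G" by (auto simp: B_def)
      qed
      moreover have "asym B"
        unfolding asym_iff B_def using col by simp metis
      moreover have "R xs j = B" using True by (simp add: R_def B_def c_def)
      ultimately show ?thesis by (simp add: orientation_def)
    qed
    fix xs assume "xs \<in> verts (power_graph m G)"
    then have V: "xs ! j \<in> verts G" if "j < m" for j using that by (auto simp: in_verts_power_graph)
    have outE: "card (R xs j `` {xs ! j}) = r" if "j < m" "\<not> j < s" for j
      using E_card(1)[OF V] r V that by (simp add: R_def)
    have outB: "card (R xs j `` {xs ! j}) = (if col (xs ! j) = col (xs ! (Suc j mod 3)) then 0 else 2 * r)"
      if "j < m" "j < s" for j
    proof -
      have "R xs j `` {xs ! j} = (if col (xs ! j) = col (xs ! (Suc j mod 3)) then {}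
        else {w. {xs ! j, w} \<in> edges G})"
        using that(2) col by (auto simp: R_def)
      then show ?thesis using regular[OF V[OF that(1)]] r(2)[OF V[OF that(1)]] by simp
    qed
    let ?f = "\<lambda>j. if T xs j then r else 0"
    let ?g = "\<lambda>j. if T xs j then 0 else card (R xs j `` {xs ! j})"
    \<comment> \<open>Balance is shown first on the triple, then pair by pair.\<close>
    have "s + 2 * p \<le> m \<Longrightarrow> sum ?f {..<s + 2 * p} = sum ?g {..<s + 2 * p}" for p
    proof (induction p)
      case 0
      show ?case using s(1)
      proof
        assume s3: "s = 3"
        have m3: "0 < m" "1 < m" "2 < m" and s3': "0 < s" "1 < s" "2 < s" using 0 s3 by auto
        have idx: "Suc 0 mod 3 = 1" "(0 + 2) mod 3 = (2::nat)" "Suc 1 mod 3 = 2" "(1 + 2) mod 3 = (0::nat)"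
          "Suc 2 mod 3 = 0" "(2 + 2) mod 3 = (1::nat)" by presburger+
        have T3: "T xs 0 \<longleftrightarrow> col (xs ! 1) \<noteq> col (xs ! 2)" "T xs 1 \<longleftrightarrow> col (xs ! 2) \<noteq> col (xs ! 0)"
          "T xs 2 \<longleftrightarrow> col (xs ! 0) \<noteq> col (xs ! 1)"
          unfolding T_def idx using s3' by (simp_all only: if_True)
        have sum3: "sum h {..<s + 2 * 0} = h 0 + h 1 + h 2" for h :: "nat \<Rightarrow> nat"
          by (simp add: s3 numeral_3_eq_3 numeral_2_eq_2)
        \<comment> \<open>With three equal colours nothing is cut and nothing goes out. Otherwise
          the direction of the block with the minority colour has out-degree \<open>2 * r\<close>,
          and the other two directions are cut, giving \<open>r\<close> cycles each.\<close>
        show ?thesis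
          unfolding sum3 outB[OF m3(1) s3'(1)] outB[OF m3(2) s3'(2)] outB[OF m3(3) s3'(3)] idx T3
          by (cases "col (xs ! 0)"; cases "col (xs ! 1)"; cases "col (xs ! 2)"; simp only: simp_thms if_True if_False; simp)
      qed simp
    next
      case (Suc p)
      \<comment> \<open>The pair contributes \<open>r\<close> cycles in its first direction and
        \<open>r\<close> outgoing arcs of \<open>E\<close> in its second.\<close>
      have "T xs (s + 2 * p)" "\<not> T xs (Suc (s + 2 * p))" by (auto simp: T_def)
      then show ?case using Suc outE[of "Suc (s + 2 * p)"] by simp
    qed
    then have eq: "sum ?f {..<m} = sum ?g {..<m}" using s(2) by simp
    have "(\<Sum>j | j < m \<and> T xs j. card {S \<in> D. xs ! j \<in> verts S}) = (\<Sum>j | j \<in> {..<m} \<and> T xs j. r)"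
      using r(1)[OF V] by (intro sum.cong) auto
    also have "\<dots> = sum ?f {..<m}" by (rule sum.inter_filter) simp
    also have "\<dots> = (\<Sum>j<m. if \<not> T xs j then card (R xs j `` {xs ! j}) else 0)"
      unfolding eq by (intro sum.cong) auto
    also have "\<dots> = (\<Sum>j | j \<in> {..<m} \<and> \<not> T xs j. card (R xs j `` {xs ! j}))"
      by (rule sum.inter_filter[symmetric]) simp
    finally show "(\<Sum>j | j < m \<and> T xs j. card {S \<in> D. xs ! j \<in> verts S}) =
      (\<Sum>j | j < m \<and> \<not> T xs j. card (R xs j `` {xs ! j}))" by simp
  qed
  then show ?thesis by (simp add: sunlet_graph_def)
qed

section \<open>Hypercubes: neighbours, parity, and block decomposition\<close>

lemma edges_hypercube:
  "edges (hypercube n) = {{x, x[i := \<not> x ! i]} | x i. length x = n \<and> i < n}"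
proof (intro equalityI subsetI)
  fix e assume "e \<in> edges (hypercube n)"
  then obtain x y where xy: "e = {x, y}" "length x = n" "length y = n"
    "card {i. i < n \<and> x ! i \<noteq> y ! i} = 1"
    by (auto simp: hypercube_def)
  from xy(4) obtain i where i: "{i. i < n \<and> x ! i \<noteq> y ! i} = {i}"
    using card_1_singletonE by blast
  have "y = x[i := \<not> x ! i]"
  proof (rule nth_equalityI)
    fix j assume "j < length y"
    then have j: "j < n" using xy by simp
    have "j \<in> {i. i < n \<and> x ! i \<noteq> y ! i} \<longleftrightarrow> j \<in> {i}" by (simp only: i)
    then have "x ! j \<noteq> y ! j \<longleftrightarrow> j = i" using j by simp
    then show "y ! j = x[i := \<not> x ! i] ! j" using j xy(2) by (cases "j = i") simp_all
  qed (use xy in simp)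
  moreover have "i < n" using i by auto
  ultimately show "e \<in> {{x, x[i := \<not> x ! i]} | x i. length x = n \<and> i < n}" using xy by blast
next
  fix e :: "bool list set" assume "e \<in> {{x, x[i := \<not> x ! i]} | x i. length x = n \<and> i < n}"
  then obtain x i where x: "e = {x, x[i := \<not> x ! i]}" "length x = n" "i < n" by blast
  have "{j. j < n \<and> x ! j \<noteq> x[i := \<not> x ! i] ! j} = {i}"
  proof (intro equalityI subsetI)
    fix j assume "j \<in> {j. j < n \<and> x ! j \<noteq> x[i := \<not> x ! i] ! j}"
    then have "x ! j \<noteq> x[i := \<not> x ! i] ! j" by simp
    then show "j \<in> {i}" by (metis nth_list_update_neq singletonI)
  qed (use x in simp)
  then have "card {j. j < n \<and> x ! j \<noteq> x[i := \<not> x ! i] ! j} = 1" by simp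
  then show "e \<in> edges (hypercube n)"
    using x unfolding hypercube_def
    by (simp only: graph.simps mem_Collect_eq) (intro exI[of _ x] exI[of _ "x[i := \<not> x ! i]"], simp)
qed

lemma hypercube_neighbours:
  assumes "length x = n"
  shows "{x, y} \<in> edges (hypercube n) \<longleftrightarrow> (\<exists>i<n. y = x[i := \<not> x ! i])"
proof
  assume "{x, y} \<in> edges (hypercube n)"
  then obtain z i where z: "{x, y} = {z, z[i := \<not> z ! i]}" "length z = n" "i < n"
    unfolding edges_hypercube by blast
  from z(1) have "y = x[i := \<not> x ! i]"
    unfolding doubleton_eq_iff
  proof
    assume "x = z[i := \<not> z ! i] \<and> y = z"
    then show ?thesis using z(2,3) by simp
  qed simp
  then show "\<exists>i<n. y = x[i := \<not> x ! i]" using z by blast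
next
  assume "\<exists>i<n. y = x[i := \<not> x ! i]"
  then show "{x, y} \<in> edges (hypercube n)" using assms unfolding edges_hypercube by blast
qed

lemma card_hypercube_neighbours:
  assumes "length x = n"
  shows "card {y. {x, y} \<in> edges (hypercube n)} = n"
proof -
  have "{y. {x, y} \<in> edges (hypercube n)} = (\<lambda>i. x[i := \<not> x ! i]) ` {..<n}"
    unfolding hypercube_neighbours[OF assms] by auto
  moreover have "inj_on (\<lambda>i. x[i := \<not> x ! i]) {..<n}"
  proof (rule inj_onI)
    fix i j assume "i \<in> {..<n}" "x[i := \<not> x ! i] = x[j := \<not> x ! j]"
    then have "x[j := \<not> x ! j] ! i = (\<not> x ! i)" using assms by (metis lessThan_iff nth_list_update_eq)
    then show "i = j" by (metis nth_list_update_neq)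
  qed
  ultimately show ?thesis by (simp add: card_image)
qed

text \<open>The number of ones changes by exactly one, so its parity is the 2-colouring that serves
  as \<open>col\<close>.\<close>

lemma even_count_list_flip:
  "i < length x \<Longrightarrow> even (count_list (x[i := \<not> x ! i]) True) \<noteq> even (count_list x True)"
proof (induction x arbitrary: i)
  case (Cons b x)
  then show ?case by (cases i) auto
qed simp

text \<open>Equal block lengths put bit \<open>i\<close> of block \<open>j\<close> at position
  \<open>j * n + i\<close>, so a change inside a block is a change of one bit of the
  concatenation.\<close>

lemma concat_list_update:
  assumes "\<forall>x \<in> set xs. length x = n" "j < length xs" "i < n"
  shows "concat (xs[j := (xs ! j)[i := b]]) = (concat xs)[j * n + i := b]"
    and "concat xs ! (j * n + i) = xs ! j ! i"
  using assms
proof (induction xs arbitrary: j)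
  case (Cons x xs)
  {
    case 1
    then show ?case using Cons.IH(1)[of "j - 1"]
      by (cases j) (auto simp: list_update_append)
  next
    case 2
    then show ?case using Cons.IH(2)[of "j - 1"]
      by (cases j) (auto simp: nth_append)
  }
qed simp_all

lemma concat_blocks_surj:
  "length x = m * n \<Longrightarrow> \<exists>xs. length xs = m \<and> (\<forall>y \<in> set xs. length y = n) \<and> x = concat xs"
proof (induction m arbitrary: x)
  case (Suc m)
  then have "length (drop n x) = m * n" by simp
  from Suc.IH[OF this] obtain xs where "length xs = m" "\<forall>y \<in> set xs. length y = n" "drop n x = concat xs"
    by blast
  then show ?case using Suc.prems append_take_drop_id[of n x]
    by (intro exI[of _ "take n x # xs"]) auto
qed simp

lemma in_verts_power_hypercube:
  "xs \<in> verts (power_graph m (hypercube n)) \<longleftrightarrow> length xs = m \<and> (\<forall>x \<in> set xs. length x = n)"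
  by (auto simp: in_verts_power_graph hypercube_def)

lemma length_concat_blocks: "\<forall>x \<in> set xs. length x = n \<Longrightarrow> length (concat xs) = length xs * n"
  by (induction xs) auto

text \<open>Cutting a string into \<open>m\<close> blocks of length \<open>n\<close> gives a vertex
  of the power, and flipping one bit moves exactly one block along an edge of
  \<open>hypercube n\<close>.\<close>

lemma hypercube_mult: "hypercube (m * n) = map_graph concat (power_graph m (hypercube n))"
proof -
  let ?P = "power_graph m (hypercube n)"
  have "verts (hypercube (m * n)) = concat ` verts ?P"
  proof (intro equalityI subsetI)
    fix x assume "x \<in> verts (hypercube (m * n))"
    then have "length x = m * n" by (simp add: hypercube_def)
    from concat_blocks_surj[OF this] obtain xs where "xs \<in> verts ?P" "x = concat xs"
      unfolding in_verts_power_hypercube by blast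
    then show "x \<in> concat ` verts ?P" by blast
  next
    fix x assume "x \<in> concat ` verts ?P"
    then obtain xs where "length xs = m" "\<forall>y \<in> set xs. length y = n" "x = concat xs"
      by (auto simp: in_verts_power_hypercube)
    then have "length x = m * n" using length_concat_blocks by blast
    then show "x \<in> verts (hypercube (m * n))" by (simp add: hypercube_def)
  qed
  moreover have "edges (hypercube (m * n)) = (`) concat ` edges ?P"
  proof (intro equalityI subsetI)
    fix e assume "e \<in> edges (hypercube (m * n))"
    then obtain x l where x: "e = {x, x[l := \<not> x ! l]}" "length x = m * n" "l < m * n"
      by (auto simp: edges_hypercube)
    from concat_blocks_surj[OF x(2)] obtain xs where
      xs: "length xs = m" "\<forall>y \<in> set xs. length y = n" "x = concat xs" by blast
    \<comment> \<open>The block containing the flipped bit, and its offset within that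
      block.\<close>
    define j i where "j = l div n" and "i = l mod n"
    have n: "n > 0" using x(3) by (cases n) auto
    have l: "l = j * n + i" "i < n" "j < m"
      using n x(3) by (auto simp: j_def i_def less_mult_imp_div_less)
    let ?w = "(xs ! j)[i := \<not> xs ! j ! i]"
    have "x[l := \<not> x ! l] = concat (xs[j := ?w])"
      unfolding xs(3) l(1) using concat_list_update[OF xs(2)] l xs(1) by simp
    then have "e = concat ` {xs, xs[j := ?w]}" using x xs by simp
    moreover have "{xs ! j, ?w} \<in> edges (hypercube n)"
      using l xs by (subst hypercube_neighbours) auto
    then have "{xs, xs[j := ?w]} \<in> edges ?P"
      using xs l unfolding edges_power_graph in_verts_power_hypercube by blast
    ultimately show "e \<in> (`) concat ` edges ?P" by (rule image_eqI)
  next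
    fix e assume "e \<in> (`) concat ` edges ?P"
    then obtain xs j w where xs: "e = concat ` {xs, xs[j := w]}" "length xs = m"
      "\<forall>x \<in> set xs. length x = n" "j < m" "{xs ! j, w} \<in> edges (hypercube n)"
      unfolding edges_power_graph in_verts_power_hypercube by blast
    have "length (xs ! j) = n" using xs by simp
    with xs(5) obtain i where i: "i < n" "w = (xs ! j)[i := \<not> xs ! j ! i]"
      by (auto simp: hypercube_neighbours)
    have jl: "j < length xs" using xs by simp
    let ?l = "j * n + i"
    have "concat (xs[j := w]) = (concat xs)[?l := \<not> concat xs ! ?l]"
      unfolding i(2) using concat_list_update[OF xs(3) jl i(1)] by simp
    then have "e = {concat xs, (concat xs)[?l := \<not> concat xs ! ?l]}" using xs by simp
    moreover have "length (concat xs) = m * n" using xs length_concat_blocks by blast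
    moreover have "?l < m * n"
    proof -
      have "?l < Suc j * n" using i by simp
      also have "\<dots> \<le> m * n" using xs(4) by (intro mult_le_mono1) simp
      finally show ?thesis .
    qed
    ultimately show "e \<in> edges (hypercube (m * n))" unfolding edges_hypercube by blast
  qed
  ultimately show ?thesis by (simp add: map_graph_def)
qed

lemma inj_on_concat_power_hypercube: "inj_on concat (verts (power_graph m (hypercube n)))"
proof (rule inj_onI)
  fix xs ys assume "xs \<in> verts (power_graph m (hypercube n))" "ys \<in> verts (power_graph m (hypercube n))"
    and eq: "concat xs = concat ys"
  then have *: "length xs = m" "\<forall>x \<in> set xs. length x = n" "length ys = m" "\<forall>y \<in> set ys. length y = n"
    by (auto simp: in_verts_power_hypercube)
  then have "\<forall>(x, y) \<in> set (zip xs ys). length x = length y"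
    by (metis (mono_tags, lifting) case_prodI2 set_zip_leftD set_zip_rightD)
  with eq * show "xs = ys" by (intro concat_injective) simp_all
qed

theorem theorem14:
  fixes n k :: nat
  assumes "n \<ge> 1" and "k \<ge> 3"
    and "has_decomposition (cycle_graph k) (hypercube n)"
  shows "\<forall>m::nat. m \<ge> 2 \<longrightarrow> has_decomposition (sunlet_graph k) (hypercube (m * n))"
proof (intro allI impI)
  fix m :: nat assume m: "m \<ge> 2"
  have "has_decomposition (sunlet_graph k) (power_graph m (hypercube n))"
  proof (rule sunlet_decomposition_power_graph[where col = "\<lambda>x. even (count_list x True)"])
    show "finite (verts (hypercube n))"
      using finite_lists_length_eq[of "UNIV :: bool set" n] by (simp add: hypercube_def)
    show "card {w. {v, w} \<in> edges (hypercube n)} = n" if "v \<in> verts (hypercube n)" for v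
      using that by (intro card_hypercube_neighbours) (simp add: hypercube_def)
    show "even (count_list u True) \<noteq> even (count_list v True)" if uv: "{u, v} \<in> edges (hypercube n)" for u v
    proof -
      have "length u = n" using simple_graphD(1)[OF simple_graph_hypercube uv] by (simp add: hypercube_def)
      then show ?thesis using uv even_count_list_flip by (auto simp: hypercube_neighbours)
    qed
  qed (use assms m simple_graph_hypercube in auto)
  then show "has_decomposition (sunlet_graph k) (hypercube (m * n))"
    unfolding hypercube_mult
    by (intro has_decomposition_map_graph simple_graph_power_graph simple_graph_hypercube
        inj_on_concat_power_hypercube)
qed

end
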